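(* Let $\mathbb{K}$ be a field and let $I \subset S=\mathbb{K}[x,y]$ be an integrally closed monomial ideal. Then $I$ satisfies the non-pure dual exchange property.
   Context: For a monomial ideal $I$ in a polynomial ring $S=\mathbb{K}[x_1,\dots,x_n]$ (here $n=2$, $x_1=x$, $x_2=y$), $G(I)$ denotes the minimal set of monomial generators of $I$. For a monomial $u=x_1^{a_1}\cdots x_n^{a_n}$, $\deg(u)=a_1+\cdots+a_n$ and $\deg_{x_i}(u)=a_i$. The ideal $I$ satisfies the non-pure dual exchange property if for all $u,v\in G(I)$ with $\deg(u)\le\deg(v)$ and for all $i$ with $\deg_{x_i}(v)<\deg_{x_i}(u)$, there exists $j$ with $\deg_{x_j}(v)>\deg_{x_j}(u)$ such that $x_i(v/x_j)\in I$. An ideal is integrally closed if it equals its integral closure: $z\in S$ is integral over $I$ if there are an integer $s \geq 1$ and $a_k\in I^k$ ($k=1,\dots,s$) with $z^s+a_1z^{s-1}+\cdots+a_{s-1}z+a_s=0$; the integral closure $\overline{I}$ is the set of all elements integral over $I$. *)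

theory Defs
  imports HOL.Modules "HOL-Library.Poly_Mapping" "HOL-Library.Numeral_Type"
begin

text \<open>
  The polynomial ring over a field \<^typ>\<open>'k\<close> with variables indexed by a finite type \<^typ>\<open>'v\<close> is
  \<^typ>\<open>('v \<Rightarrow>\<^sub>0 nat) \<Rightarrow>\<^sub>0 'k\<close> (finitely supported functions on exponent vectors, multiplied by
  convolution).  Two variables are obtained with the index type \<^typ>\<open>2\<close>.
  A monomial is represented by its exponent vector; \<open>Poly_Mapping.lookup u i\<close> is its degree
  in the \<open>i\<close>-th variable.
\<close>

type_synonym 'v exponents = "'v \<Rightarrow>\<^sub>0 nat"
type_synonym ('v, 'k) mpoly = "('v \<Rightarrow>\<^sub>0 nat) \<Rightarrow>\<^sub>0 'k"

text \<open>Ideals of a commutative ring are the submodules of the ring over itself;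
  \<open>ideal.span B\<close> is the ideal generated by \<open>B\<close>.\<close>

interpretation ideal: module "(*) :: 'a \<Rightarrow> 'a \<Rightarrow> 'a::comm_ring_1"
  by unfold_locales (simp_all add: algebra_simps)

definition monomial :: "'v exponents \<Rightarrow> ('v, 'k::field) mpoly"
  where "monomial u = Poly_Mapping.single u 1"

definition variable :: "'v \<Rightarrow> ('v, 'k::field) mpoly"
  where "variable i = monomial (Poly_Mapping.single i 1)"

definition total_degree :: "'v::finite exponents \<Rightarrow> nat"
  where "total_degree u = (\<Sum>i\<in>UNIV. Poly_Mapping.lookup u i)"


section \<open>Monomial ideals and their minimal monomial generators\<close>

definition monomial_generators :: "('v, 'k::field) mpoly set \<Rightarrow> 'v exponents set \<Rightarrow> bool"
  where "monomial_generators I M \<longleftrightarrow> I = ideal.span (monomial ` M)"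

definition monomial_ideal :: "('v, 'k::field) mpoly set \<Rightarrow> bool"
  where "monomial_ideal I \<longleftrightarrow> (\<exists>M. monomial_generators I M)"

definition minimal_monomial_generators ::
    "('v, 'k::field) mpoly set \<Rightarrow> 'v exponents set \<Rightarrow> bool"
  where "minimal_monomial_generators I M \<longleftrightarrow>
    monomial_generators I M \<and> (\<forall>N. N \<subset> M \<longrightarrow> \<not> monomial_generators I N)"

text \<open>For a monomial ideal the minimal generating set of monomials exists and is unique,
  see \<open>ex1_minimal_monomial_generators\<close> below.\<close>

definition min_gens :: "('v, 'k::field) mpoly set \<Rightarrow> 'v exponents set"
  where "min_gens I = (THE M. minimal_monomial_generators I M)"


section \<open>The non-pure dual exchange property\<close>

text \<open>In the conclusion \<open>v\<close> is divisible by the \<open>j\<close>-th variable, so the subtraction of exponents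
  is not truncated.\<close>

definition non_pure_dual_exchange :: "('v::finite, 'k::field) mpoly set \<Rightarrow> bool"
  where "non_pure_dual_exchange I \<longleftrightarrow>
    (\<forall>u\<in>min_gens I. \<forall>v\<in>min_gens I. total_degree u \<le> total_degree v \<longrightarrow>
      (\<forall>i. Poly_Mapping.lookup v i < Poly_Mapping.lookup u i \<longrightarrow>
        (\<exists>j. Poly_Mapping.lookup v j > Poly_Mapping.lookup u j \<and>
             variable i * monomial (v - Poly_Mapping.single j 1) \<in> I)))"


section \<open>Integral closure\<close>

primrec ideal_power :: "'a::comm_ring_1 set \<Rightarrow> nat \<Rightarrow> 'a set"
  where
    "ideal_power I 0 = UNIV"
  | "ideal_power I (Suc k) = ideal.span {a * b | a b. a \<in> I \<and> b \<in> ideal_power I k}"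

definition integral_over_ideal :: "'a::comm_ring_1 \<Rightarrow> 'a set \<Rightarrow> bool"
  where "integral_over_ideal z I \<longleftrightarrow>
    (\<exists>s\<ge>1. \<exists>a :: nat \<Rightarrow> 'a. (\<forall>k\<in>{1..s}. a k \<in> ideal_power I k) \<and>
       z ^ s + (\<Sum>k=1..s. a k * z ^ (s - k)) = 0)"

definition integral_closure :: "'a::comm_ring_1 set \<Rightarrow> 'a set"
  where "integral_closure I = {z. integral_over_ideal z I}"

definition integrally_closed :: "'a::comm_ring_1 set \<Rightarrow> bool"
  where "integrally_closed I \<longleftrightarrow> integral_closure I = I"


section \<open>Existence and uniqueness of the minimal monomial generating set\<close>

lemma monomial_add: "monomial (s + t) = monomial s * monomial t"
  by (simp add: monomial_def mult_single)

lemma keys_span_monomials: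
  assumes "p \<in> ideal.span (monomial ` M :: ('v, 'k::field) mpoly set)"
      and "s \<in> Poly_Mapping.keys p"
  shows "\<exists>t\<in>M. \<exists>r. s = r + t"
proof -
  let ?P = "\<lambda>p :: ('v, 'k) mpoly. \<forall>s\<in>Poly_Mapping.keys p. \<exists>t\<in>M. \<exists>r. s = r + t"
  have "?P p"
    using assms(1)
  proof (induction rule: ideal.span_induct_alt)
    case base
    show ?case by simp
  next
    case (step c x y)
    obtain t where t: "t \<in> M" "x = monomial t"
      using step.hyps by blast
    show ?case
    proof
      fix s assume "s \<in> Poly_Mapping.keys (c * x + y)"
      then consider "s \<in> Poly_Mapping.keys (c * x)" | "s \<in> Poly_Mapping.keys y"
        using keys_add[of "c * x" y] by blast
      then show "\<exists>t\<in>M. \<exists>r. s = r + t"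
      proof cases
        case 1
        then obtain a b where ab: "a \<in> Poly_Mapping.keys c" "b \<in> Poly_Mapping.keys x" "s = a + b"
          using keys_mult[of c x] by blast
        then have "b = t"
          by (simp add: t monomial_def split: if_splits)
        then show ?thesis
          using ab t by blast
      next
        case 2
        then show ?thesis
          using step.IH by blast
      qed
    qed
  qed
  then show ?thesis
    using assms(2) by blast
qed

lemma monomial_in_span_iff:
  "(monomial s :: ('v, 'k::field) mpoly) \<in> ideal.span (monomial ` M) \<longleftrightarrow> (\<exists>t\<in>M. \<exists>r. s = r + t)"
proof
  assume "(monomial s :: ('v, 'k) mpoly) \<in> ideal.span (monomial ` M)"
  then show "\<exists>t\<in>M. \<exists>r. s = r + t"
    by (rule keys_span_monomials) (simp add: monomial_def)
next
  assume "\<exists>t\<in>M. \<exists>r. s = r + t"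
  then obtain t r where "t \<in> M" "s = r + t" by blast
  moreover from \<open>t \<in> M\<close> have "(monomial t :: ('v, 'k) mpoly) \<in> ideal.span (monomial ` M)"
    by (intro ideal.span_base imageI)
  ultimately show "(monomial s :: ('v, 'k) mpoly) \<in> ideal.span (monomial ` M)"
    by (simp add: monomial_add ideal.span_scale)
qed

definition divisibility_minimal :: "('v, 'k::field) mpoly set \<Rightarrow> 'v exponents set"
  where "divisibility_minimal I =
    {t. monomial t \<in> I \<and> (\<forall>s r. monomial s \<in> I \<longrightarrow> t = r + s \<longrightarrow> s = t)}"

lemma total_degree_add: "total_degree (s + t) = total_degree s + total_degree t"
  by (simp add: total_degree_def lookup_add sum.distrib)

lemma total_degree_eq_0_iff: "total_degree t = 0 \<longleftrightarrow> t = 0"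
  by (auto simp: total_degree_def poly_mapping_eq_iff fun_eq_iff)

lemma ex_divisibility_minimal:
  fixes I :: "('v::finite, 'k::field) mpoly set"
  assumes "monomial s \<in> I"
  shows "\<exists>t\<in>divisibility_minimal I. \<exists>r. s = r + t"
  using assms
proof (induction "total_degree s" arbitrary: s rule: less_induct)
  case less
  show ?case
  proof (cases "s \<in> divisibility_minimal I")
    case True
    then show ?thesis by (metis add_0)
  next
    case False
    then obtain s' r where s': "monomial s' \<in> I" "s = r + s'" "s' \<noteq> s"
      using less.prems unfolding divisibility_minimal_def by blast
    then have "r \<noteq> 0" by auto
    then have "total_degree s' < total_degree s"
      using s' total_degree_eq_0_iff[of r] by (simp add: total_degree_add)
    then obtain t r' where "t \<in> divisibility_minimal I" "s' = r' + t"
      using less.hyps s' by blast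
    then show ?thesis
      using s' by (metis add.assoc)
  qed
qed

lemma divisibility_minimal_subset:
  fixes I :: "('v, 'k::field) mpoly set"
  assumes "monomial_generators I M"
  shows "divisibility_minimal I \<subseteq> M"
proof
  fix t assume t: "t \<in> divisibility_minimal I"
  then have "(monomial t :: ('v, 'k) mpoly) \<in> ideal.span (monomial ` M)"
    using assms by (simp add: divisibility_minimal_def monomial_generators_def)
  then obtain s r where s: "s \<in> M" "t = r + s"
    by (auto simp: monomial_in_span_iff)
  then have "monomial s \<in> I"
    using assms by (auto simp: monomial_generators_def intro!: ideal.span_base)
  then show "t \<in> M"
    using t s by (auto simp: divisibility_minimal_def)
qed

lemma monomial_generators_divisibility_minimal:
  fixes I :: "('v::finite, 'k::field) mpoly set"
  assumes "monomial_ideal I"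
  shows "monomial_generators I (divisibility_minimal I)"
proof -
  obtain M where M: "I = ideal.span (monomial ` M)"
    using assms by (auto simp: monomial_ideal_def monomial_generators_def)
  have "monomial ` divisibility_minimal I \<subseteq> I"
    by (auto simp: divisibility_minimal_def)
  then have "ideal.span (monomial ` divisibility_minimal I) \<subseteq> I"
    by (rule ideal.span_minimal) (simp add: M)
  moreover have "(monomial ` M :: ('v, 'k) mpoly set) \<subseteq> ideal.span (monomial ` divisibility_minimal I)"
  proof
    fix x :: "('v, 'k) mpoly" assume "x \<in> monomial ` M"
    then obtain s where s: "x = monomial s" "s \<in> M" by blast
    then have "(monomial s :: ('v, 'k) mpoly) \<in> I"
      unfolding M by (intro ideal.span_base) blast
    then show "x \<in> ideal.span (monomial ` divisibility_minimal I)"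
      unfolding s by (simp add: monomial_in_span_iff ex_divisibility_minimal)
  qed
  then have "I \<subseteq> ideal.span (monomial ` divisibility_minimal I)"
    by (subst (1) M, intro ideal.span_minimal) simp_all
  ultimately show ?thesis
    by (auto simp: monomial_generators_def)
qed

lemma minimal_monomial_generators_iff:
  fixes I :: "('v::finite, 'k::field) mpoly set"
  assumes "monomial_ideal I"
  shows "minimal_monomial_generators I M \<longleftrightarrow> M = divisibility_minimal I"
  using monomial_generators_divisibility_minimal[OF assms] divisibility_minimal_subset
  unfolding minimal_monomial_generators_def by blast

lemma ex1_minimal_monomial_generators:
  fixes I :: "('v::finite, 'k::field) mpoly set"
  assumes "monomial_ideal I"
  shows "\<exists>!M. minimal_monomial_generators I M"
  by (simp add: minimal_monomial_generators_iff[OF assms])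

lemma min_gens_eq_divisibility_minimal:
  fixes I :: "('v::finite, 'k::field) mpoly set"
  assumes "monomial_ideal I"
  shows "min_gens I = divisibility_minimal I"
  by (simp add: min_gens_def minimal_monomial_generators_iff[OF assms])

end

theory Submission
  imports Defs
begin

text \<open>
  If \<open>u\<close>, \<open>v\<close> are generators with \<open>p = deg\<^sub>x u - deg\<^sub>x v > 0\<close> and \<open>deg u \<le> deg v\<close>, then
  \<open>q = deg\<^sub>y v - deg\<^sub>y u \<ge> p\<close>.  The lattice point \<open>z = x v / y\<close> lies weakly above the segment from
  \<open>v\<close> to \<open>u\<close>: indeed \<open>z\<^sup>p = y\<^bsup>q - p\<^esup> u v\<^bsup>p - 1\<^esup> \<in> I\<^sup>p\<close>, so \<open>z\<close> is integral over \<open>I\<close>.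
\<close>

lemma ideal_power_scale: "x \<in> ideal_power I n \<Longrightarrow> c * x \<in> ideal_power I n"
  by (cases n) (auto intro: ideal.span_scale)

lemma zero_in_ideal_power: "0 \<in> ideal_power I n"
  by (cases n) (auto intro: ideal.span_zero)

lemma mult_in_ideal_power:
  assumes "x \<in> I" and "y \<in> ideal_power I n"
  shows "x * y \<in> ideal_power I (Suc n)"
  using assms by (auto intro!: ideal.span_base)

lemma power_in_ideal_power: "x \<in> I \<Longrightarrow> x ^ n \<in> ideal_power I n"
proof (induction n)
  case (Suc n)
  then show ?case
    unfolding power_Suc by (intro mult_in_ideal_power) auto
qed simp

text \<open>The element \<open>z\<close> is a root of \<open>X^n - z^n\<close>, which is an equation
  of integral dependence because its only lower coefficient \<open>- (z ^ n)\<close> lies in the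
  \<open>n\<close>-th power of \<open>I\<close>.\<close>

lemma integrally_closed_root:
  assumes "integrally_closed I" and "n > 0" and "z ^ n \<in> ideal_power I n"
  shows "z \<in> I"
proof -
  let ?a = "\<lambda>k. if k = n then - (z ^ n) else 0"
  have "- (z ^ n) \<in> ideal_power I n"
    using ideal_power_scale[OF assms(3), of "- 1"] by simp
  then have "\<forall>k\<in>{1..n}. ?a k \<in> ideal_power I k"
    by (simp add: zero_in_ideal_power)
  moreover have "(\<Sum>k=1..n. ?a k * z ^ (n - k)) = (\<Sum>k=1..n. if k = n then - (z ^ n) else 0)"
    by (rule sum.cong) auto
  then have "z ^ n + (\<Sum>k=1..n. ?a k * z ^ (n - k)) = 0"
    using assms(2) by simp
  ultimately have "integral_over_ideal z I"
    unfolding integral_over_ideal_def using assms(2)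
    by (intro exI[of _ n] conjI exI[of _ ?a]) auto
  then show ?thesis
    using assms(1) by (auto simp: integrally_closed_def integral_closure_def)
qed

lemma monomial_power: "monomial s ^ n = monomial (\<Sum>k<n. s)"
  by (induction n) (simp_all add: monomial_def mult_single add.commute flip: single_one)

text \<open>The hypothesis on exponents says that \<open>u v^n\<close> divides
  \<open>s^(n+1)\<close>. As a product of \<open>n + 1\<close> elements of \<open>I\<close>,
  \<open>u v^n\<close> lies in the power \<open>n + 1\<close> of \<open>I\<close>, hence so does
  \<open>s^(n+1)\<close>.\<close>

lemma integrally_closed_monomial:
  fixes I :: "('v, 'k::field) mpoly set"
  assumes "integrally_closed I" and "monomial u \<in> I" and "monomial v \<in> I"
    and "\<And>k. Poly_Mapping.lookup u k + n * Poly_Mapping.lookup v k \<le> Suc n * Poly_Mapping.lookup s k"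
  shows "monomial s \<in> I"
proof (rule integrally_closed_root[OF assms(1)])
  define t where "t = u + (\<Sum>k<n. v)"
  \<comment> \<open>Divisibility by \<open>t\<close> makes the truncated subtraction of exponents
    exact.\<close>
  have "(\<Sum>k<Suc n. s) = ((\<Sum>k<Suc n. s) - t) + t"
  proof (rule poly_mapping_eqI)
    fix k
    have "Poly_Mapping.lookup t k \<le> Poly_Mapping.lookup (\<Sum>k<Suc n. s) k"
      using assms(4)[of k] by (simp add: t_def lookup_add lookup_sum)
    then show "Poly_Mapping.lookup (\<Sum>k<Suc n. s) k
        = Poly_Mapping.lookup (((\<Sum>k<Suc n. s) - t) + t) k"
      unfolding lookup_add lookup_minus by simp
  qed
  then have "(monomial s :: ('v, 'k) mpoly) ^ Suc n
      = monomial ((\<Sum>k<Suc n. s) - t) * (monomial u * monomial v ^ n)"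
    unfolding monomial_power t_def monomial_add[symmetric] by simp
  also have "\<dots> \<in> ideal_power I (Suc n)"
    using assms(2,3) by (intro ideal_power_scale mult_in_ideal_power power_in_ideal_power)
  finally show "(monomial s :: ('v, 'k) mpoly) ^ Suc n \<in> ideal_power I (Suc n)" .
qed simp

theorem theorem2p5:
  fixes I :: "(2, 'k::field) mpoly set"
  assumes "monomial_ideal I"
      and "integrally_closed I"
  shows "non_pure_dual_exchange I"
  unfolding non_pure_dual_exchange_def
proof (intro ballI impI allI)
  fix u v :: "2 exponents" and i
  assume "u \<in> min_gens I" and "v \<in> min_gens I"
    and deg: "total_degree u \<le> total_degree v" and i: "Poly_Mapping.lookup v i < Poly_Mapping.lookup u i"
  then have uv: "monomial u \<in> I" "monomial v \<in> I"
    by (auto simp: min_gens_eq_divisibility_minimal[OF assms(1)] divisibility_minimal_def)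
  \<comment> \<open>There are only two variables, so \<open>j\<close> has to be the other
    one.\<close>
  obtain j where j: "j \<noteq> i" and UNIV: "UNIV = {i, j}"
  proof -
    have "card (UNIV :: 2 set) = 2" by simp
    then show ?thesis
      using that unfolding card_2_iff by (metis UNIV_I insert_iff insert_commute singletonD)
  qed
  have deg': "Poly_Mapping.lookup u i + Poly_Mapping.lookup u j \<le> Poly_Mapping.lookup v i + Poly_Mapping.lookup v j"
    using deg j by (simp add: total_degree_def UNIV)
  \<comment> \<open>Here \<open>n = p - 1\<close>, so the root to be taken has exponent
    \<open>Suc n = p\<close>.\<close>
  define n where "n = Poly_Mapping.lookup u i - Poly_Mapping.lookup v i - 1"
  define s where "s = Poly_Mapping.single i 1 + (v - Poly_Mapping.single j 1)"
  have n: "Poly_Mapping.lookup u i = Poly_Mapping.lookup v i + Suc n"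
    using i by (simp add: n_def)
  \<comment> \<open>The last summand is \<open>q - p\<close>, not truncated since
    \<open>q \<ge> p\<close>. In particular \<open>v\<close> is divisible by the variable
    \<open>j\<close>.\<close>
  have vj: "Poly_Mapping.lookup v j = Poly_Mapping.lookup u j + Suc n + (Poly_Mapping.lookup v j - Poly_Mapping.lookup u j - Suc n)"
    using deg' n by simp
  have s: "Poly_Mapping.lookup s i = Poly_Mapping.lookup v i + 1" "Poly_Mapping.lookup v j = Poly_Mapping.lookup s j + 1"
    using j vj by (auto simp: s_def lookup_add lookup_minus lookup_single)
  have "Poly_Mapping.lookup u k + n * Poly_Mapping.lookup v k \<le> Suc n * Poly_Mapping.lookup s k" for k
  proof -
    consider "k = i" | "k = j" using UNIV by blast
    then show ?thesis
    proof cases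
      case 1
      then show ?thesis by (simp add: s n)
    next
      case 2
      \<comment> \<open>Substituting \<open>s_j + 1\<close> for \<open>v_j\<close> and cancelling
        \<open>n * s_j\<close> leaves exactly this inequality.\<close>
      have "Poly_Mapping.lookup u j + n \<le> Poly_Mapping.lookup s j"
        using s(2) vj by linarith
      then show ?thesis
        unfolding 2 s(2) by simp
    qed
  qed
  then have "monomial s \<in> I"
    by (rule integrally_closed_monomial[OF assms(2) uv])
  moreover have "Poly_Mapping.lookup u j < Poly_Mapping.lookup v j"
    using vj by linarith
  ultimately show "\<exists>j. Poly_Mapping.lookup v j > Poly_Mapping.lookup u j \<and>
      variable i * monomial (v - Poly_Mapping.single j 1) \<in> I"
    by (auto simp: variable_def s_def monomial_add)
qed

end
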